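(* Let $\lambda/\mu$ be a basic skew diagram with $\delta(\lambda/\mu)=n$. Then $\overline{\lambda/\mu}\ \geq\ \overline{\delta_n/\delta_{n-1}}$ in the poset of equivalence classes of basic skew diagrams.
   Context: Partitions: a partition $\lambda=(\lambda_1,\lambda_2,\ldots)$ is a weakly decreasing sequence of non-negative integers with finitely many positive entries (trailing zeros are ignored); $l(\lambda)$ is the number of positive parts; $dp(\lambda)$ is the number of different (positive) parts of $\lambda$. Its diagram has $\lambda_i$ left-justified boxes in row $i$. For $n\ge 1$, $\delta_n=(n,n-1,\ldots,2,1)$, and $\delta_0=\emptyset$. The skew diagram $\delta_n/\delta_{n-1}$ consists of $n$ pairwise disconnected single boxes (for $n=0$ it is read as the empty diagram). For $\mu\subseteq\lambda$ the skew diagram $\lambda/\mu$ is the set of boxes of $\lambda$ not in $\mu$. It is basic if $\mu_i<\lambda_i$ and $\mu_i\le\lambda_{i+1}$ for each $1\le i\le l(\lambda)$ (equivalently, no empty rows or columns); a basic skew diagram determines $\lambda$ and $\mu$. Operations: $\mu+\nu$ is the partition with parts $\mu_i+\nu_i$; $\mu\cup\nu$ is the partition whose multiset of parts is the union of those of $\mu$ and $\nu$. For skew diagrams, $\lambda/\mu+\lambda'/\mu'=(\lambda+\lambda')/(\mu+\mu')$ and $\lambda/\mu\cup\lambda'/\mu'=(\lambda\cup\lambda')/(\mu\cup\mu')$. Here $(1^x)$ denotes the partition with $x$ parts equal to $1$, and $(x)$ the partition with one part $x$. Covering of basic skew diagrams: for basic skew diagrams $\alpha/\beta$ and $\lambda/\mu$,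 $\lambda/\mu$ covers $\alpha/\beta$ if either $\lambda/\mu=\alpha/\beta+(1^x)/(1^y)$ with $0\le y\le x\le l(\alpha)$, $x\ge1$, or $\lambda/\mu=\alpha/\beta\cup(x)/(y)$ with $0\le y\le x\le\alpha_1$, $x\geq 1$. Equivalence classes: a skew diagram $\mathcal D$ decays into non-empty sub-diagrams $\mathcal A,\mathcal B$ if $\mathcal D=\mathcal A\cup\mathcal B$ as sets of boxes and no box of $\mathcal A$ is in the same row or column as a box of $\mathcal B$; it is connected if it does not decay. Two basic skew diagrams are equivalent if they are the same up to translation of the connected skew diagrams into which they decompose (i.e. they have the same multiset of connected components up to translation). $\overline{\lambda/\mu}$ denotes the equivalence class of $\lambda/\mu$. Order on classes: $\overline{\lambda/\mu}$ covers $\overline{\alpha/\beta}$ if some $\mathcal A\in\overline{\lambda/\mu}$ covers some $\mathcal B\in\overline{\alpha/\beta}$; the partial order $\ge$ on equivalence classes is the reflexive transitive closure of this covering relation. $\delta$ value: for a basic skew diagram, $\delta(\lambda/\mu)=\min\big(dp(\mu)+1,\,dp(\lambda)\big)$. *)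

theory Defs
  imports "HOL-Library.Multiset" "HOL-Library.More_List" "HOL-Library.Product_Plus"
begin

section \<open>Partitions\<close>

text \<open>Sequences are indexed from 0: if \<open>p\<close> represents the partition \<open>\<lambda>\<close>, then
  \<open>p i\<close> is the part \<open>\<lambda>\<^sub>i\<^sub>+\<^sub>1\<close>.\<close>

type_synonym partition = "nat \<Rightarrow> nat"

definition is_partition :: "partition \<Rightarrow> bool" where
  "is_partition p \<longleftrightarrow> antimono p \<and> finite {i. p i > 0}"

definition len :: "partition \<Rightarrow> nat" where
  "len p = card {i. p i > 0}"

definition dp :: "partition \<Rightarrow> nat" where
  "dp p = card (range p - {0})"

definition parts :: "partition \<Rightarrow> nat multiset" where
  "parts p = image_mset p (mset_set {i. p i > 0})"

definition psum :: "partition \<Rightarrow> partition \<Rightarrow> partition" where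
  "psum p q = (\<lambda>i. p i + q i)"

text \<open>The parts of both partitions are sorted into decreasing order and padded with zeros.\<close>

definition punion :: "partition \<Rightarrow> partition \<Rightarrow> partition" where
  "punion p q = nth_default 0 (rev (sorted_list_of_multiset (parts p + parts q)))"

definition col_part :: "nat \<Rightarrow> partition" where
  "col_part x = (\<lambda>i. if i < x then 1 else 0)"

definition row_part :: "nat \<Rightarrow> partition" where
  "row_part x = (\<lambda>i. if i = 0 then x else 0)"

definition staircase :: "nat \<Rightarrow> partition" where
  "staircase n = (\<lambda>i. n - i)"

lemma set_mset_parts:
  assumes "is_partition p"
  shows "set_mset (parts p) = range p - {0}"
  using assms unfolding parts_def is_partition_def by auto

lemma antimono_nth_default_rev:
  fixes xs :: "nat list"
  assumes "sorted xs"
  shows "antimono (nth_default 0 (rev xs))"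
proof (rule antimonoI)
  fix i j :: nat
  assume ij: "i \<le> j"
  show "nth_default 0 (rev xs) j \<le> nth_default 0 (rev xs) i"
  proof (cases "j < length xs")
    case True
    then have "xs ! (length xs - Suc j) \<le> xs ! (length xs - Suc i)"
      using assms ij by (intro sorted_nth_mono) auto
    then show ?thesis
      using True ij by (simp add: nth_default_def rev_nth)
  qed (simp add: nth_default_def)
qed

lemma is_partition_punion: "is_partition (punion p q)"
proof -
  let ?xs = "rev (sorted_list_of_multiset (parts p + parts q))"
  have "{i. nth_default 0 ?xs i > 0} \<subseteq> {..<length ?xs}"
    by (auto simp: nth_default_def split: if_splits)
  then show ?thesis
    unfolding is_partition_def punion_def
    using finite_subset by (blast intro: antimono_nth_default_rev sorted_sorted_list_of_multiset)
qed

lemma parts_punion: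
  assumes "is_partition p" "is_partition q"
  shows "parts (punion p q) = parts p + parts q"
proof -
  define xs where "xs = rev (sorted_list_of_multiset (parts p + parts q))"
  have ms: "mset xs = parts p + parts q"
    by (simp add: xs_def)
  have "0 \<notin> set_mset (mset xs)"
    unfolding ms using assms by (simp add: set_mset_parts)
  then have pos: "xs ! i > 0" if "i < length xs" for i
    using nth_mem[OF that] by (metis gr0I set_mset_mset)
  have "{i. nth_default 0 xs i > 0} = {0..<length xs}"
    using pos by (auto simp: nth_default_def split: if_splits)
  then have "parts (punion p q) = image_mset (nth_default 0 xs) (mset [0..<length xs])"
    by (simp add: parts_def punion_def xs_def flip: mset_upt)
  also have "\<dots> = mset (map (nth_default 0 xs) [0..<length xs])"
    by simp
  also have "map (nth_default 0 xs) [0..<length xs] = xs"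
    by (rule nth_equalityI) (auto simp: nth_default_def)
  finally show ?thesis
    using ms by simp
qed


section \<open>Skew diagrams\<close>

text \<open>The skew diagram \<open>\<lambda>/\<mu>\<close> is given by the pair \<open>(\<lambda>, \<mu>)\<close>; \<open>boxes\<close> is its set of boxes,
  (row, column), again counted from 0.\<close>

type_synonym skew = "partition \<times> partition"

type_synonym diagram = "(int \<times> int) set"

definition is_skew :: "skew \<Rightarrow> bool" where
  "is_skew = (\<lambda>(l, m). is_partition l \<and> is_partition m \<and> (\<forall>i. m i \<le> l i))"

definition boxes :: "skew \<Rightarrow> diagram" where
  "boxes = (\<lambda>(l, m). {(int i, int j) |i j. m i \<le> j \<and> j < l i})"

definition basic :: "skew \<Rightarrow> bool" where
  "basic = (\<lambda>(l, m). is_skew (l, m) \<and> (\<forall>i < len l. m i < l i \<and> m i \<le> l (Suc i)))"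

definition skew_sum :: "skew \<Rightarrow> skew \<Rightarrow> skew" where
  "skew_sum = (\<lambda>(l, m) (l', m'). (psum l l', psum m m'))"

definition skew_union :: "skew \<Rightarrow> skew \<Rightarrow> skew" where
  "skew_union = (\<lambda>(l, m) (l', m'). (punion l l', punion m m'))"

definition delta_value :: "skew \<Rightarrow> nat" where
  "delta_value = (\<lambda>(l, m). min (dp m + 1) (dp l))"

definition covers :: "skew \<Rightarrow> skew \<Rightarrow> bool" where
  "covers D A \<longleftrightarrow> basic D \<and> basic A \<and>
     ((\<exists>x y. y \<le> x \<and> x \<le> len (fst A) \<and> 1 \<le> x \<and> D = skew_sum A (col_part x, col_part y)) \<or>
      (\<exists>x y. y \<le> x \<and> x \<le> fst A 0 \<and> 1 \<le> x \<and> D = skew_union A (row_part x, row_part y)))"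


section \<open>Connected components and equivalence classes\<close>

definition separated :: "diagram \<Rightarrow> diagram \<Rightarrow> bool" where
  "separated A B \<longleftrightarrow> (\<forall>a\<in>A. \<forall>b\<in>B. fst a \<noteq> fst b \<and> snd a \<noteq> snd b)"

definition decays :: "diagram \<Rightarrow> diagram \<Rightarrow> diagram \<Rightarrow> bool" where
  "decays D A B \<longleftrightarrow> A \<noteq> {} \<and> B \<noteq> {} \<and> D = A \<union> B \<and> separated A B"

definition diagram_connected :: "diagram \<Rightarrow> bool" where
  "diagram_connected D \<longleftrightarrow> (\<nexists>A B. decays D A B)"

text \<open>The non-empty connected pieces into which \<open>D\<close> decomposes: those which share no row and no
  column with the remaining boxes of \<open>D\<close>.\<close>

definition components :: "diagram \<Rightarrow> diagram set" where
  "components D = {C. C \<subseteq> D \<and> C \<noteq> {} \<and> diagram_connected C \<and> separated C (D - C)}"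

definition translates :: "diagram \<Rightarrow> diagram \<Rightarrow> bool" where
  "translates A B \<longleftrightarrow> (\<exists>t. B = (+) t ` A)"

text \<open>The same multiset of components up to translation: there is a bijection between the
  components that matches translates, so multiplicities are respected.\<close>

definition skew_equiv :: "(skew \<times> skew) set" where
  "skew_equiv = {(D, E). basic D \<and> basic E \<and>
     (\<exists>f. bij_betw f (components (boxes D)) (components (boxes E)) \<and>
          (\<forall>C \<in> components (boxes D). translates C (f C)))}"

definition skew_classes :: "skew set set" where
  "skew_classes = {D. basic D} // skew_equiv"

definition skew_class :: "skew \<Rightarrow> skew set" where
  "skew_class D = skew_equiv `` {D}"

definition class_covers :: "skew set \<Rightarrow> skew set \<Rightarrow> bool" where
  "class_covers X Y \<longleftrightarrow> X \<in> skew_classes \<and> Y \<in> skew_classes \<and> (\<exists>A\<in>X. \<exists>B\<in>Y. covers A B)"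

definition class_ge :: "skew set \<Rightarrow> skew set \<Rightarrow> bool" where
  "class_ge = class_covers\<^sup>*\<^sup>*"

lemma translates_refl: "translates A A"
  unfolding translates_def by (rule exI[of _ 0]) auto

lemma translates_sym:
  assumes "translates A B"
  shows "translates B A"
proof -
  obtain t where "B = (+) t ` A"
    using assms unfolding translates_def by blast
  then have "A = (+) (- t) ` B"
    by (simp add: image_image)
  then show ?thesis
    unfolding translates_def by blast
qed

lemma translates_trans:
  assumes "translates A B" "translates B C"
  shows "translates A C"
proof -
  obtain s t where "B = (+) s ` A" "C = (+) t ` B"
    using assms unfolding translates_def by blast
  then have "C = (+) (t + s) ` A"
    by (simp add: image_image add.assoc)
  then show ?thesis
    unfolding translates_def by blast
qed

lemma equiv_skew_equiv: "equiv {D. basic D} skew_equiv"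
proof (rule equivI)
  show "skew_equiv \<subseteq> {D. basic D} \<times> {D. basic D}"
    unfolding skew_equiv_def by auto
  show "refl_on {D. basic D} skew_equiv"
    unfolding skew_equiv_def refl_on_def using translates_refl bij_betw_id by fastforce
  show "sym skew_equiv"
  proof (rule symI)
    fix D E
    assume "(D, E) \<in> skew_equiv"
    then obtain f where b: "basic D" "basic E"
      and f: "bij_betw f (components (boxes D)) (components (boxes E))"
      and t: "\<forall>C \<in> components (boxes D). translates C (f C)"
      unfolding skew_equiv_def by blast
    let ?g = "inv_into (components (boxes D)) f"
    have "\<forall>C \<in> components (boxes E). translates C (?g C)"
      using f t by (metis bij_betw_imp_surj_on f_inv_into_f inv_into_into translates_sym)
    then show "(E, D) \<in> skew_equiv"
      unfolding skew_equiv_def using b bij_betw_inv_into[OF f] by blast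
  qed
  show "trans skew_equiv"
  proof (rule transI)
    fix D E F
    assume "(D, E) \<in> skew_equiv" "(E, F) \<in> skew_equiv"
    then obtain f g where b: "basic D" "basic F"
      and f: "bij_betw f (components (boxes D)) (components (boxes E))"
      and tf: "\<forall>C \<in> components (boxes D). translates C (f C)"
      and g: "bij_betw g (components (boxes E)) (components (boxes F))"
      and tg: "\<forall>C \<in> components (boxes E). translates C (g C)"
      unfolding skew_equiv_def by blast
    have "\<forall>C \<in> components (boxes D). translates C ((g \<circ> f) C)"
      using f tf tg translates_trans by (metis bij_betwE comp_apply)
    then show "(D, F) \<in> skew_equiv"
      unfolding skew_equiv_def using b bij_betw_trans[OF f g] by blast
  qed
qed

text \<open>For \<open>n = 0\<close> truncated subtraction gives \<open>(staircase 0, staircase 0)\<close>, the empty diagram.\<close>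

lemma basic_staircase: "basic (staircase n, staircase (n - 1))"
proof -
  have "{i. n - i > 0} = {..<n}"
    by auto
  then have "len (staircase n) = n" "finite {i. n - i > 0}"
    by (simp_all add: len_def staircase_def)
  moreover have "finite {i. n - 1 - i > 0}"
    by (rule finite_subset[of _ "{..<n}"]) auto
  ultimately show ?thesis
    by (auto simp: basic_def is_skew_def is_partition_def staircase_def intro!: antimonoI)
qed

end

theory Submission
  imports Defs
begin

text \<open>
  Induct on \<open>\<lambda>\<^sub>1 + l(\<lambda>)\<close>. A component that is a single box can be moved to the top right without
  leaving the class; the induction hypothesis applies to the rest, and placing a box at the top
  right turns coverings into coverings and \<open>\<delta>\<^sub>n/\<delta>\<^sub>n\<^sub>-\<^sub>1\<close> into \<open>\<delta>\<^sub>n\<^sub>+\<^sub>1/\<delta>\<^sub>n\<close>. It remains to see that a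
  non-empty diagram without single-box components covers a diagram with the same \<open>\<delta>\<close> value.

  Suppose it does not. Then \<open>dp \<lambda> = dp \<mu> + 1\<close>, since otherwise some row \<open>k + 1\<close> of \<open>\<lambda>\<close> can be removed
  together with row \<open>k\<close> of \<open>\<mu>\<close>. A component starts either with two equal parts of \<open>\<lambda>\<close> or with a
  column step of length \<open>\<ge> 2\<close> of \<open>\<mu>\<close>, and ends either with two equal parts of \<open>\<mu>\<close> or with a column step of
  length \<open>\<ge> 2\<close> of \<open>\<lambda>\<close>. Removing pairs of equal parts, or pairs of long steps, shows that every
  component is of one of two types, has no such pair inside, and that neighbouring components have
  the same type. So \<open>\<mu>\<close>, respectively \<open>\<lambda>\<close>, has no equal parts at all, which forces
  \<open>dp \<mu> = l(\<lambda>) - 1\<close>, respectively \<open>dp \<lambda> = l(\<lambda>)\<close>, and contradicts the equal parts of the other one.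

  Without the passage to classes the statement fails: no \<open>\<delta>\<close>-preserving removal is possible in
  \<open>(5,5,3,2,1)/(4,3,2)\<close>.
\<close>

section \<open>Partitions\<close>

lemma partition_antimono: "is_partition p \<Longrightarrow> i \<le> j \<Longrightarrow> p j \<le> p i"
  unfolding is_partition_def by (auto dest: antimonoD)

lemma is_partitionI:
  assumes "\<And>i. p (Suc i) \<le> p i" "p N = 0"
  shows "is_partition p"
proof -
  have a: "antimono p"
    using assms(1) by (simp add: antimono_iff_le_Suc)
  have "{i. p i > 0} \<subseteq> {..<N}"
    using antimonoD[OF a, of N] assms(2) by (auto intro: ccontr)
  then show ?thesis
    unfolding is_partition_def using a finite_subset by blast
qed

lemma partition_support:
  assumes "is_partition p"
  shows "{i. p i > 0} = {..<len p}"
proof -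
  have fin: "finite {i. p i > 0}"
    using assms by (simp add: is_partition_def)
  show ?thesis
  proof (cases "p 0 = 0")
    case True
    then have "{i. p i > 0} = {}"
      using partition_antimono[OF assms, of 0] by auto
    then show ?thesis
      unfolding len_def by simp
  next
    case False
    define n where "n = Max {i. p i > 0}"
    have "{i. p i > 0} = {..n}"
    proof
      show "{i. p i > 0} \<subseteq> {..n}"
        using fin by (auto simp: n_def)
      have "p n > 0"
        using Max_in[OF fin] False unfolding n_def by blast
      then show "{..n} \<subseteq> {i. p i > 0}"
        using partition_antimono[OF assms, of _ n] by fastforce
    qed
    then show ?thesis
      unfolding len_def by (simp add: lessThan_Suc_atMost)
  qed
qed

lemma partition_pos_iff: "is_partition p \<Longrightarrow> 0 < p i \<longleftrightarrow> i < len p"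
  using partition_support[of p] by auto

lemma partition_zero_iff: "is_partition p \<Longrightarrow> p i = 0 \<longleftrightarrow> len p \<le> i"
  using partition_pos_iff[of p i] by linarith

lemma partition_finite_range:
  assumes "is_partition p"
  shows "finite (range p)"
proof -
  have "range p \<subseteq> {..p 0}"
    using partition_antimono[OF assms] by auto
  then show ?thesis
    using finite_subset by blast
qed

lemma partition_zero_in_range: "is_partition p \<Longrightarrow> 0 \<in> range p"
  by (metis order_refl partition_zero_iff rangeI)

lemma card_range_partition:
  assumes "is_partition p"
  shows "card (range p) = Suc (dp p)"
  unfolding dp_def
  using card_Suc_Diff1[OF partition_finite_range[OF assms] partition_zero_in_range[OF assms]] by simp

lemma parts_eq_mset:
  assumes "is_partition p"
  shows "parts p = mset (map p [0..<len p])"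
  unfolding parts_def partition_support[OF assms]
  by (simp add: lessThan_atLeast0 flip: mset_upt)

text \<open>A partition is determined by its multiset of parts, since its positive entries are
  already in decreasing order. Later unions are recognised by comparing
  \<open>parts\<close>.\<close>

lemma punion_eqI:
  assumes "is_partition p" "parts p = parts q + parts r"
  shows "punion q r = p"
proof -
  let ?xs = "map p [0..<len p]"
  have "sorted (rev ?xs)"
    by (auto simp: sorted_iff_nth_mono rev_nth intro!: partition_antimono[OF assms(1)])
  then have "sorted_list_of_multiset (parts p) = rev ?xs"
    unfolding parts_eq_mset[OF assms(1)]
    by (metis mset_rev sorted_list_of_multiset_mset sorted_sort_id)
  then have "punion q r = nth_default 0 ?xs"
    unfolding punion_def assms(2)[symmetric] by simp
  also have "\<dots> = p"
    using partition_zero_iff[OF assms(1)] by (auto simp: nth_default_def not_less)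
  finally show ?thesis .
qed

lemma size_parts: "is_partition p \<Longrightarrow> size (parts p) = len p"
  by (simp add: parts_eq_mset)

lemma is_partition_row_part: "is_partition (row_part x)"
  by (rule is_partitionI[of _ 1]) (auto simp: row_part_def)

lemma parts_row_part: "parts (row_part x) = (if x = 0 then {#} else {#x#})"
proof -
  have "{i. row_part x i > 0} = (if x = 0 then {} else {0})"
    by (auto simp: row_part_def)
  then show ?thesis
    by (simp add: parts_def row_part_def)
qed

lemma dp_le: "is_partition p \<Longrightarrow> p n = 0 \<Longrightarrow> dp p \<le> n"
proof -
  assume a: "is_partition p" "p n = 0"
  have "i < n" if "p i \<noteq> 0" for i
    using partition_antimono[OF a(1), of n i] a(2) that by (cases "i < n") auto
  then have "range p - {0} \<subseteq> p ` {..<n}"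
    by auto
  then show ?thesis
    unfolding dp_def by (metis card_lessThan finite_lessThan surj_card_le)
qed

lemma dp_ge_strict:
  assumes "is_partition p" "\<And>i. i < n \<Longrightarrow> p (Suc i) < p i"
  shows "n \<le> dp p"
proof -
  have lt: "p j < p i" if "i < j" "i < n" for i j
    using partition_antimono[OF assms(1), of "Suc i" j] assms(2)[of i] that by simp
  have "inj_on p {..<n}"
    by (rule inj_onI) (metis lessThan_iff less_irrefl linorder_neqE_nat lt)
  moreover have "p ` {..<n} \<subseteq> range p - {0}"
    using assms(2) by fastforce
  ultimately show ?thesis
    unfolding dp_def
    by (metis card_image card_lessThan card_mono finite_Diff partition_finite_range[OF assms(1)])
qed

section \<open>Removing a row or a column\<close>

definition del :: "nat \<Rightarrow> partition \<Rightarrow> partition" where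
  "del k p = (\<lambda>i. if i < k then p i else p (Suc i))"

definition dec :: "nat \<Rightarrow> partition \<Rightarrow> partition" where
  "dec x p = (\<lambda>i. if i < x then p i - 1 else p i)"

lemma is_partition_del:
  assumes "is_partition p"
  shows "is_partition (del k p)"
  by (rule is_partitionI[of _ "len p"])
    (auto simp: del_def partition_zero_iff[OF assms] intro: partition_antimono[OF assms])

lemma punion_del:
  assumes "is_partition p"
  shows "punion (del k p) (row_part (p k)) = p"
proof (rule punion_eqI[OF assms])
  note d = is_partition_del[OF assms, of k]
  show "parts p = parts (del k p) + parts (row_part (p k))"
  proof (cases "k < len p")
    case False
    then have "del k p = p" "p k = 0"
      by (auto simp: del_def partition_zero_iff[OF assms] fun_eq_iff)
        (metis assms le_Suc_eq not_less order_trans partition_zero_iff)+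
    then show ?thesis
      by (simp add: parts_row_part)
  next
    case True
    have "i < len (del k p) \<longleftrightarrow> i < len p - 1" for i
      unfolding partition_pos_iff[OF d, symmetric] using True
      by (auto simp: del_def partition_pos_iff[OF assms])
    then have l: "len (del k p) = len p - 1"
      by (meson linorder_neqE_nat less_irrefl)
    have "map (del k p) [0..<len p - 1] = map p [0..<k] @ map p [Suc k..<len p]"
      using True by (intro nth_equalityI) (auto simp: del_def nth_append)
    moreover have "[0..<len p] = [0..<k] @ k # [Suc k..<len p]"
      using True upt_add_eq_append[of 0 k "len p - k"] by (simp add: upt_conv_Cons)
    moreover have "p k \<noteq> 0"
      using True partition_pos_iff[OF assms] by simp
    ultimately show ?thesis
      by (simp add: parts_eq_mset[OF assms] parts_eq_mset[OF d] l parts_row_part)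
  qed
qed

lemma dp_del_le: "is_partition p \<Longrightarrow> dp (del k p) \<le> dp p"
  unfolding dp_def
  by (intro card_mono finite_Diff partition_finite_range) (auto simp: del_def)

lemma dp_le_Suc_del:
  assumes "is_partition p"
  shows "dp p \<le> Suc (dp (del k p))"
proof -
  have "p i \<in> insert (p k) (range (del k p))" for i
    by (cases i k rule: linorder_cases)
      (auto simp: del_def image_iff intro: exI[of _ i] exI[of _ "i - 1"])
  then have "range p - {0} \<subseteq> insert (p k) (range (del k p) - {0})"
    by auto
  moreover have "finite (range (del k p) - {0})"
    using partition_finite_range[OF is_partition_del[OF assms]] by blast
  ultimately have "dp p \<le> card (insert (p k) (range (del k p) - {0}))"
    unfolding dp_def by (intro card_mono) auto
  also have "\<dots> \<le> Suc (dp (del k p))"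
    unfolding dp_def using partition_finite_range[OF is_partition_del[OF assms]] by (simp add: card_insert_if)
  finally show ?thesis .
qed

text \<open>The deleted value survives in an adjacent row. Without the guard \<open>0 < k\<close>,
  truncation of \<open>k - 1\<close> would make the first equation trivial at
  \<open>k = 0\<close>.\<close>

lemma dp_del_eq:
  assumes "(0 < k \<and> p k = p (k - 1)) \<or> p k = p (Suc k)"
  shows "dp (del k p) = dp p"
proof -
  have "p i \<in> range (del k p)" for i
    using assms
    by (cases i k rule: linorder_cases)
      (auto simp: del_def image_iff intro: exI[of _ i] exI[of _ "i - 1"])
  then have "range (del k p) = range p"
    by (auto simp: del_def)
  then show ?thesis
    by (simp add: dp_def)
qed

lemma is_partition_dec:
  assumes "is_partition p" "p (Suc x) < p x"
  shows "is_partition (dec (Suc x) p)"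
proof (rule is_partitionI[of _ "len p"])
  show "dec (Suc x) p (Suc i) \<le> dec (Suc x) p i" for i
    using partition_antimono[OF assms(1), of i "Suc i"] assms(2)
    by (cases "i = x") (auto simp: dec_def)
  show "dec (Suc x) p (len p) = 0"
    using partition_zero_iff[OF assms(1), of "len p"] by (simp add: dec_def)
qed

text \<open>A step of length at least 2 leaves a gap, so lowering all values above it by one neither
  merges two values nor sends a positive value to 0.\<close>

lemma dp_dec:
  assumes "is_partition p" "p (Suc x) + 2 \<le> p x"
  shows "dp (dec (Suc x) p) = dp p"
proof -
  define g where "g v = (if v > p (Suc x) then v - 1 else v)" for v
  have big: "p i \<ge> p x" if "i < Suc x" for i
    using partition_antimono[OF assms(1), of i x] that by simp
  have small: "p i \<le> p (Suc x)" if "\<not> i < Suc x" for i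
    using partition_antimono[OF assms(1), of "Suc x" i] that by simp
  have dec: "dec (Suc x) p i = g (p i)" for i
    using big[of i] small[of i] assms(2) by (auto simp: dec_def g_def)
  have vals: "p i \<ge> p (Suc x) + 2 \<or> p i \<le> p (Suc x)" for i
    using big[of i] small[of i] assms(2) by force
  have "range (dec (Suc x) p) - {0} = g ` (range p - {0})"
  proof -
    have "g (p i) = 0 \<longleftrightarrow> p i = 0" for i
      using vals[of i] by (auto simp: g_def)
    then show ?thesis
      by (fastforce simp: dec)
  qed
  moreover have "inj_on g (range p)"
  proof (rule inj_onI, clarify)
    fix i j
    assume "g (p i) = g (p j)"
    then show "p i = p j"
      using vals[of i] vals[of j] by (auto simp: g_def split: if_splits)
  qed
  ultimately show ?thesis
    unfolding dp_def by (metis Diff_subset card_image inj_on_subset)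
qed


section \<open>Basic skew diagrams\<close>

lemma basic_iff:
  "basic (l, m) \<longleftrightarrow> is_partition l \<and> is_partition m \<and>
     (\<forall>i. m i \<le> l (Suc i) \<and> (m i < l i \<or> l i = 0))"
proof (cases "is_partition l")
  case True
  have *: "l i = 0 \<and> l (Suc i) = 0" if "\<not> i < len l" for i
    using that partition_zero_iff[OF True] by auto
  show ?thesis
  proof
    assume "basic (l, m)"
    then show "is_partition l \<and> is_partition m \<and> (\<forall>i. m i \<le> l (Suc i) \<and> (m i < l i \<or> l i = 0))"
      unfolding basic_def is_skew_def using * by (simp, metis le_zero_eq)
  next
    assume a: "is_partition l \<and> is_partition m \<and> (\<forall>i. m i \<le> l (Suc i) \<and> (m i < l i \<or> l i = 0))"
    then have "m i \<le> l i" for i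
      using partition_antimono[OF True, of i "Suc i"] by (meson le_SucI order_refl order_trans)
    then show "basic (l, m)"
      unfolding basic_def is_skew_def using a partition_pos_iff[OF True] by (auto, metis less_irrefl)
  qed
qed (auto simp: basic_def is_skew_def)

text \<open>Taking \<open>0 < k\<close> keeps the first part of \<open>l\<close> in place, which
  bounds the removed row as covering demands.\<close>

lemma covers_row:
  assumes "basic (l, m)" "basic (del k l, del j m)" "0 < k" "0 < l k" "m j \<le> l k"
  shows "covers (l, m) (del k l, del j m)"
proof -
  have p: "is_partition l" "is_partition m"
    using assms(1) by (auto simp: basic_iff)
  have "(l, m) = skew_union (del k l, del j m) (row_part (l k), row_part (m j))"
    by (simp add: skew_union_def punion_del p)
  moreover have "l k \<le> del k l 0"
    using assms(3) partition_antimono[OF p(1)] by (simp add: del_def)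
  ultimately show ?thesis
    unfolding covers_def using assms by (fastforce simp: Suc_le_eq)
qed

text \<open>Entries of at least 2 stay positive, so the smaller diagram still has \<open>x\<close>
  rows, as covering demands.\<close>

lemma covers_col:
  assumes "basic (l, m)" "basic (dec x l, dec y m)" "0 < x" "y \<le> x"
    and "\<And>i. i < x \<Longrightarrow> 2 \<le> l i" "\<And>i. i < y \<Longrightarrow> 1 \<le> m i"
  shows "covers (l, m) (dec x l, dec y m)"
proof -
  have "psum (dec x l) (col_part x) = l"
  proof
    show "psum (dec x l) (col_part x) i = l i" for i
      using assms(5)[of i] by (auto simp: psum_def dec_def col_part_def)
  qed
  moreover have "psum (dec y m) (col_part y) = m"
  proof
    show "psum (dec y m) (col_part y) i = m i" for i
      using assms(6)[of i] by (auto simp: psum_def dec_def col_part_def)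
  qed
  moreover have "0 < dec x l (x - 1)"
    using assms(3) assms(5)[of "x - 1"] by (simp add: dec_def)
  then have "x \<le> len (dec x l)"
    using partition_pos_iff[of "dec x l" "x - 1"] assms(2,3) by (simp add: basic_iff)
  ultimately have "y \<le> x \<and> x \<le> len (fst (dec x l, dec y m)) \<and> 1 \<le> x \<and>
      (l, m) = skew_sum (dec x l, dec y m) (col_part x, col_part y)"
    using assms(3,4) by (simp add: skew_sum_def)
  then show ?thesis
    unfolding covers_def using assms(1,2) by blast
qed

text \<open>Measure for the final induction: an added column raises the first part and an added row
  raises the length, while neither lowers the other quantity.\<close>

lemma covers_size:
  assumes "covers (l, m) (a, b)"
  shows "a 0 + len a < l 0 + len l"
proof -
  have p: "is_partition l" "is_partition a"
    using assms by (auto simp: covers_def basic_iff)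
  consider x where "1 \<le> x" "l = psum a (col_part x)"
    | x where "1 \<le> x" "l = punion a (row_part x)"
    using assms by (auto simp: covers_def skew_sum_def skew_union_def)
  then show ?thesis
  proof cases
    case 1
    then have "len a \<le> len l"
      unfolding len_def using p(1) by (intro card_mono) (auto simp: is_partition_def psum_def)
    moreover have "l 0 = Suc (a 0)"
      using 1 by (simp add: psum_def col_part_def)
    ultimately show ?thesis by simp
  next
    case 2
    then have parts: "parts l = add_mset x (parts a)"
      using p by (simp add: parts_punion is_partition_row_part parts_row_part)
    then have "len l = Suc (len a)"
      using p by (metis size_add_mset size_parts)
    moreover have "a 0 \<le> l 0"
    proof (cases "a 0 = 0")
      case False
      then have "a 0 \<in># parts l"
        using parts p by (simp add: set_mset_parts)
      then show ?thesis
        using p partition_antimono[of l 0] by (auto simp: set_mset_parts)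
    qed simp
    ultimately show ?thesis by simp
  qed
qed


section \<open>Irreducible diagrams\<close>

text \<open>A counterexample to the reduction step, refuted in \<open>absurd\<close>. Rows
  \<open>i - 1\<close> and \<open>i\<close> share no column exactly when
  \<open>m (i - 1) = l i\<close>, so the last assumption excludes single-box components.\<close>

locale irreducible_skew =
  fixes l m :: partition
  assumes basic: "basic (l, m)"
    and irreducible: "covers (l, m) D \<Longrightarrow> delta_value D \<noteq> delta_value (l, m)"
    and nonempty: "0 < l 0"
    and no_single_box: "i = 0 \<or> m (i - 1) = l i \<Longrightarrow> m i = l (Suc i) \<Longrightarrow> l i \<noteq> Suc (m i)"
begin

lemma l_part: "is_partition l" and m_part: "is_partition m"
  and m_le: "m i \<le> l (Suc i)" and m_lt': "m i < l i \<or> l i = 0"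
  using basic by (auto simp: basic_iff)

lemmas l_anti = partition_antimono[OF l_part]
lemmas m_anti = partition_antimono[OF m_part]
lemmas l_pos = partition_pos_iff[OF l_part]
lemmas l_zero = partition_zero_iff[OF l_part]

lemma m_lt: "i < len l \<Longrightarrow> m i < l i"
  using m_lt'[of i] l_pos[of i] by auto

lemma m_zero: "len l \<le> Suc i \<Longrightarrow> m i = 0"
  using m_le[of i] l_zero[of "Suc i"] by simp

section \<open>Removal of rows\<close>

lemma no_row_removal:
  assumes "0 < k" "k < len l" "m j \<le> l k" "basic (del k l, del j m)"
  shows "min (dp (del j m) + 1) (dp (del k l)) \<noteq> min (dp m + 1) (dp l)"
  using irreducible[OF covers_row[OF basic assms(4) assms(1) _ assms(3)]] assms(2) l_pos
  by (simp add: delta_value_def)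

text \<open>Between the two deleted rows \<open>m\<close> is replaced by its next entry, which is no
  larger, while \<open>l\<close> stays; elsewhere both sequences shift together or not at
  all.\<close>

lemma basic_del:
  assumes "j < k"
  shows "basic (del k l, del j m)"
  unfolding basic_iff
proof (intro conjI allI is_partition_del l_part m_part)
  fix i
  have "m (Suc i) \<le> m i"
    using m_anti by simp
  then show "del j m i \<le> del k l (Suc i)" "del j m i < del k l i \<or> del k l i = 0"
    using assms m_le[of i] m_le[of "Suc i"] m_lt'[of i] m_lt'[of "Suc i"] by (auto simp: del_def)
qed

lemma dp_m_bound: "dp m \<le> len l - 1"
  using dp_le[OF m_part, of "len l - 1"] m_zero by simp

lemma dp_exact: "dp l = dp m + 1"
proof (rule ccontr)
  assume "dp l \<noteq> dp m + 1"
  then consider "dp m + 1 < dp l" | "dp l < dp m + 1"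
    by linarith
  then show False
  proof cases
    case 1
    \<comment> \<open>With only \<open>dp m\<close> positive values, \<open>m\<close> repeats among
      its first \<open>dp m + 2\<close> entries. Deleting a repeated entry keeps
      \<open>dp m\<close>, and \<open>dp l\<close> has one to spare.\<close>
    have "\<exists>i < dp m + 1. \<not> m (Suc i) < m i"
      using dp_ge_strict[OF m_part, of "dp m + 1"] by force
    then obtain i where i: "i \<le> dp m" "m i = m (Suc i)"
      using m_anti[of _ "Suc _"] by (metis Suc_eq_plus1 le_SucI less_Suc_eq_le order.order_iff_strict order_refl)
    have "dp l \<le> len l"
      using dp_le[OF l_part] l_zero by simp
    then have "Suc i < len l"
      using 1 i by simp
    then show False
      using no_row_removal[of "Suc i" i] m_le[of i] basic_del[of i "Suc i"]
        dp_del_eq[of i m] i 1 dp_del_le[OF l_part, of "Suc i"] dp_le_Suc_del[OF l_part, of "Suc i"]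
      by simp
  next
    case 2
    \<comment> \<open>Dually, \<open>dp_m_bound\<close> forces \<open>dp l < len l\<close>, so two
      positive parts of \<open>l\<close> agree, and now \<open>dp m\<close> has one to
      spare.\<close>
    have "\<exists>i. Suc i < len l \<and> \<not> l (Suc i) < l i"
    proof (rule ccontr)
      assume neg: "\<not> ?thesis"
      have "len l \<le> dp l"
      proof (rule dp_ge_strict[OF l_part])
        fix i assume "i < len l"
        then show "l (Suc i) < l i"
          using neg l_zero[of "Suc i"] l_pos[of i] by (cases "Suc i < len l") auto
      qed
      then show False
        using dp_m_bound 2 nonempty l_pos[of 0] by auto
    qed
    then obtain i where i: "Suc i < len l" "l (Suc i) = l i"
      using l_anti[of _ "Suc _"] by (metis le_SucI order.order_iff_strict order_refl)
    then show False
      using no_row_removal[of "Suc i" i] m_le[of i] basic_del[of i "Suc i"]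
        dp_del_eq[of "Suc i" l] 2 dp_del_le[OF m_part, of i] dp_le_Suc_del[OF m_part, of i]
      by simp
  qed
qed

text \<open>Deleting one of two equal entries on each side changes neither \<open>dp\<close>, so
  only a failure of being basic can prevent this removal.\<close>

lemma no_row_pair:
  assumes "Suc k < len l" "l (Suc k) = l k" "Suc j < len l" "m (Suc j) = m j" "m j \<le> l (Suc k)"
  shows "\<not> basic (del (Suc k) l, del j m)"
  using no_row_removal[of "Suc k" j] assms dp_del_eq[of "Suc k" l] dp_del_eq[of j m] by auto

lemma no_row_pair_above:
  assumes "Suc k < len l" "l (Suc k) = l k" "Suc j < len l" "m (Suc j) = m j" "m j \<le> l (Suc k)"
  shows "k < j"
  using no_row_pair[OF assms] basic_del[of j "Suc k"] by force

text \<open>The obstructions to removing the two columns: rows \<open>i\<close> and \<open>i + 1\<close> are separated, or row \<open>i\<close>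
  consists of a single box and would become empty.\<close>

lemma dec_cond:
  assumes "y \<le> Suc t" "l (Suc t) + 2 \<le> l t" "y = 0 \<or> m y + 2 \<le> m (y - 1)"
  shows "\<exists>i. y \<le> i \<and> i < t \<and> (m i = l (Suc i) \<or> Suc (m i) = l i)"
proof (rule ccontr)
  assume neg: "\<not> ?thesis"
  have t: "t < len l"
    using assms(2) l_pos[of t] by simp
  have n1: "m i < l (Suc i)" "Suc (m i) < l i" if "y \<le> i" "i < t" for i
    using neg that m_le[of i] m_lt[of i] t by (auto simp: le_less less_eq_Suc_le[symmetric])
  have P: "is_partition (dec (Suc t) l)"
    using is_partition_dec[OF l_part] assms(2) by simp
  have Q: "is_partition (dec y m)" "dp (dec y m) = dp m"
  proof -
    consider "y = 0" | z where "y = Suc z" "m (Suc z) + 2 \<le> m z"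
      using assms(3) by (cases y) auto
    then have "is_partition (dec y m) \<and> dp (dec y m) = dp m"
    proof cases
      case 1
      then show ?thesis using m_part by (simp add: dec_def)
    next
      case 2
      then show ?thesis using is_partition_dec[OF m_part, of z] dp_dec[OF m_part, of z] by simp
    qed
    then show "is_partition (dec y m)" "dp (dec y m) = dp m" by auto
  qed
  have my: "2 \<le> m i" if "i < y" for i
    using assms(3) m_anti[of i "y - 1"] that by (cases y) auto
  have "basic (dec (Suc t) l, dec y m)"
    unfolding basic_iff
  proof (intro conjI allI P Q(1))
    fix i
    show "dec y m i \<le> dec (Suc t) l (Suc i)"
      using m_le[of i] n1(1)[of i] my[of i] assms(1) by (auto simp: dec_def)
    \<comment> \<open>Only rows from \<open>y\<close> to \<open>t\<close> are at risk, where
      \<open>l\<close> loses a box and \<open>m\<close> does not. Before row \<open>t\<close> this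
      is covered by \<open>n1\<close>; row \<open>t\<close> survives because
      \<open>m t \<le> l (Suc t)\<close> and the step of \<open>l\<close> there is at least
      2.\<close>
    show "dec y m i < dec (Suc t) l i \<or> dec (Suc t) l i = 0"
      using m_lt'[of i] n1(2)[of i] my[of i] assms(1,2) m_le[of t]
      by (cases "i = t") (auto simp: dec_def)
  qed
  moreover have "2 \<le> l i" if "i < Suc t" for i
    using l_anti[of i t] assms(2) that by simp
  ultimately have "covers (l, m) (dec (Suc t) l, dec y m)"
    using covers_col[OF basic, of "Suc t" y] assms(1) my by fastforce
  then show False
    using irreducible Q(2) dp_dec[OF l_part assms(2)] by (force simp: delta_value_def)
qed

text \<open>A row with a single box, not separated from the next row, lies above an equal part of \<open>l\<close>; then
  a row removal is possible instead.\<close>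

lemma no_col_pair:
  assumes "y \<le> Suc t" "l (Suc t) + 2 \<le> l t"
    and y: "y = 0 \<and> m 0 + 2 \<le> l 0 \<or> 0 < y \<and> m y + 2 \<le> m (y - 1)"
  shows "\<exists>i. y \<le> i \<and> i < t \<and> m i = l (Suc i)"
proof (rule ccontr)
  assume neg: "\<not> ?thesis"
  obtain i where i: "y \<le> i" "i < t" "Suc (m i) = l i"
    using dec_cond[of y t] assms neg by blast
  have "m i \<noteq> l (Suc i)"
    using neg i by blast
  then have li: "l (Suc i) = l i"
    using i m_le[of i] l_anti[of i "Suc i"] by simp
  have si: "Suc i < len l"
    using li i(3) l_pos[of "Suc i"] by simp
  show False
  proof (cases i)
    case 0
    then show False using y i by simp
  next
    case (Suc h)
    have "m i \<le> m h"
      using m_anti Suc by simp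
    \<comment> \<open>Otherwise rows \<open>i\<close>, \<open>Suc i\<close> of \<open>l\<close> and
      rows \<open>h\<close>, \<open>i\<close> of \<open>m\<close> form a removable pair of equal
      parts.\<close>
    moreover have "m h \<noteq> m i"
      using no_row_pair_above[of i h] si li i Suc by fastforce
    moreover have "m h \<le> l i"
      using m_le Suc by simp
    ultimately have h: "m h = l i"
      using i(3) by simp
    \<comment> \<open>Rows \<open>h\<close> and \<open>i\<close> share no column, which
      \<open>neg\<close> allows only for \<open>h < y\<close>. But then the step of \<open>m\<close>
      from row \<open>h\<close> to row \<open>y\<close> has length 1 instead of at least 2.\<close>
    then have "y = i"
      using neg i Suc by (metis Suc_lessD le_SucE)
    then show False
      using y h i Suc by simp
  qed
qed

text \<open>Here \<open>l\<close> is pulled up by one row against \<open>m\<close> between the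
  deleted rows. The alternatives are the failures of the two shifted inequalities
  \<open>m i \<le> l (Suc (Suc i))\<close> and \<open>m i < l (Suc i)\<close>.\<close>

lemma del_cond:
  assumes "k < j" "Suc k < len l" "l (Suc k) = l k" "Suc j < len l" "m (Suc j) = m j"
  shows "\<exists>i. k \<le> i \<and> i < j \<and> (l (Suc (Suc i)) < m i \<or> m i = l (Suc i))"
proof (rule ccontr)
  assume neg: "\<not> ?thesis"
  have n1: "m i \<le> l (Suc (Suc i))" "m i < l (Suc i)" if "k \<le> i" "i < j" for i
  proof -
    have "\<not> l (Suc (Suc i)) < m i" "m i \<noteq> l (Suc i)"
      using neg that by blast+
    then show "m i \<le> l (Suc (Suc i))" "m i < l (Suc i)"
      using m_le[of i] by simp_all
  qed
  have "m j \<le> m k" using m_anti assms by simp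
  then have "m j \<le> l (Suc k)"
    using m_le[of k] by simp
  moreover have "basic (del (Suc k) l, del j m)"
    unfolding basic_iff
  proof (intro conjI allI is_partition_del l_part m_part)
    fix i
    show "del j m i \<le> del (Suc k) l (Suc i)"
      using n1(1)[of i] m_le[of i] m_le[of "Suc i"] assms(1) by (auto simp: del_def)
    show "del j m i < del (Suc k) l i \<or> del (Suc k) l i = 0"
      using n1(2)[of i] m_lt'[of i] m_lt'[of "Suc i"] assms(1) by (auto simp: del_def)
  qed
  ultimately show False
    using no_row_pair assms by blast
qed

text \<open>In the other alternative of \<open>del_cond\<close>, without a separation,
  \<open>l\<close> has a step of length at least 2 at row \<open>Suc i\<close>. By
  \<open>no_col_pair\<close> with an empty range \<open>m\<close> has no such step there, so
  \<open>m (Suc i) = l (Suc (Suc i))\<close>. This is a separation unless \<open>Suc i = j\<close>,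
  and in that case row \<open>Suc j\<close> would be empty.\<close>

lemma no_row_pair_below:
  assumes "k < j" "Suc k < len l" "l (Suc k) = l k" "Suc j < len l" "m (Suc j) = m j"
  shows "\<exists>i. k \<le> i \<and> i < j \<and> m i = l (Suc i)"
proof (rule ccontr)
  assume neg: "\<not> ?thesis"
  obtain i where i: "k \<le> i" "i < j" "l (Suc (Suc i)) < m i"
    using del_cond[OF assms] neg by blast
  have "m i < l (Suc i)"
    using neg i m_le[of i] by (auto simp: le_less)
  then have big: "l (Suc (Suc i)) + 2 \<le> l (Suc i)"
    using i by simp
  have "\<not> m (Suc i) + 2 \<le> m i"
    using no_col_pair[of "Suc i" "Suc i"] big by auto
  then have touch: "m (Suc i) = l (Suc (Suc i))"
    using i m_le[of "Suc i"] by simp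
  then have "Suc i = j"
    using neg i by (metis Suc_lessI le_SucI)
  then show False
    using touch assms m_lt[of "Suc j"] by simp
qed

section \<open>Connected components as intervals of rows\<close>

text \<open>The equation \<open>m i = l (Suc i)\<close> says that rows \<open>i\<close> and
  \<open>Suc i\<close> share no column; after the last row of the diagram it holds as
  \<open>0 = 0\<close>.\<close>

definition component :: "nat \<Rightarrow> nat \<Rightarrow> bool" where
  "component s t \<longleftrightarrow> s \<le> t \<and> t < len l \<and> (s = 0 \<or> m (s - 1) = l s) \<and> m t = l (Suc t) \<and>
     (\<forall>i. s \<le> i \<longrightarrow> i < t \<longrightarrow> m i \<noteq> l (Suc i))"

lemma component_exists:
  assumes "i < len l"
  obtains s t where "component s t" "s \<le> i" "i \<le> t"
proof -
  have last: "m (len l - 1) = l (Suc (len l - 1))"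
    using assms m_zero[of "len l - 1"] l_zero[of "len l"] by simp
  define t where "t = (LEAST t. i \<le> t \<and> m t = l (Suc t))"
  have w: "i \<le> len l - 1 \<and> m (len l - 1) = l (Suc (len l - 1))"
    using last assms by simp
  have t: "i \<le> t \<and> m t = l (Suc t)" "t \<le> len l - 1"
    unfolding t_def
    using LeastI[of "\<lambda>t. i \<le> t \<and> m t = l (Suc t)", OF w] Least_le[of "\<lambda>t. i \<le> t \<and> m t = l (Suc t)", OF w]
    by blast+
  have tmin: "m j \<noteq> l (Suc j)" if "i \<le> j" "j < t" for j
    using not_less_Least[of j "\<lambda>t. i \<le> t \<and> m t = l (Suc t)"] that by (auto simp: t_def)
  define S where "S = {s. s \<le> i \<and> (s = 0 \<or> m (s - 1) = l s)}"
  have "finite S" "0 \<in> S"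
    by (auto simp: S_def)
  then have s: "Max S \<in> S" and smax: "\<And>x. x \<in> S \<Longrightarrow> x \<le> Max S"
    using Max_in by auto
  have "m j \<noteq> l (Suc j)" if "Max S \<le> j" "j < t" for j
  proof (cases "i \<le> j")
    case False
    then have "Suc j \<notin> S"
      using smax[of "Suc j"] that by linarith
    then show ?thesis
      using False by (simp add: S_def)
  qed (simp add: tmin that)
  then have "component (Max S) t" "Max S \<le> i" "i \<le> t"
    using s t assms by (auto simp: component_def S_def)
  then show ?thesis by (rule that)
qed

text \<open>A single box in the first row must be followed by another row of the component, and then
  \<open>m s < l (Suc s) \<le> l s = Suc (m s)\<close> leaves no room for a step of
  \<open>l\<close>.\<close>

lemma component_start:
  assumes "component s t" "\<not> m s + 2 \<le> l s"
  shows "s < t" "l (Suc s) = l s"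
proof -
  have s: "Suc (m s) = l s"
    using assms m_lt[of s] by (auto simp: component_def)
  then show st: "s < t"
    using assms(1) no_single_box[of s] by (auto simp: component_def le_less)
  then have "m s \<noteq> l (Suc s)"
    using assms(1) by (auto simp: component_def)
  then show "l (Suc s) = l s"
    using s m_le[of s] l_anti[of s "Suc s"] by simp
qed

lemma component_end:
  assumes "component s t" "\<not> m t + 2 \<le> l t"
  shows "s < t" "m (t - 1) = m t"
proof -
  have t: "Suc (m t) = l t"
    using assms m_lt[of t] by (auto simp: component_def)
  then show st: "s < t"
    using assms(1) no_single_box[of t] by (auto simp: component_def le_less)
  then have "m (t - 1) \<noteq> l t"
    using assms(1) by (auto simp: component_def dest: spec[of _ "t - 1"])
  then show "m (t - 1) = m t"
    using t st m_le[of "t - 1"] m_anti[of "t - 1" t] by simp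
qed

text \<open>For \<open>0 < s\<close> the length of row \<open>s\<close> equals the step of
  \<open>m\<close> before it, because \<open>m (s - 1) = l s\<close>. This is the form in which
  \<open>no_col_pair\<close> wants a long first row.\<close>

lemma component_start_col:
  assumes "component s t" "m s + 2 \<le> l s"
  shows "s = 0 \<and> m 0 + 2 \<le> l 0 \<or> 0 < s \<and> m s + 2 \<le> m (s - 1)"
  using assms by (auto simp: component_def)

lemma no_row_pair_component:
  assumes "component s t" "s \<le> k" "k < t" "l (Suc k) = l k" "s \<le> j" "j < t" "m (Suc j) = m j"
    "m j \<le> l (Suc k)"
  shows False
proof -
  have *: "Suc k < len l" "Suc j < len l"
    using assms by (auto simp: component_def)
  have "k < j"
    using no_row_pair_above[of k j] assms * by blast
  from no_row_pair_below[OF this] assms * obtain i where "k \<le> i" "i < j" "m i = l (Suc i)"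
    by blast
  then show False
    using assms by (auto simp: component_def)
qed

text \<open>Long first and last rows would give a removable pair of columns; two short ones give
  equal parts of \<open>l\<close> at the start and of \<open>m\<close> at the end, a removable pair
  of rows.\<close>

lemma component_type:
  assumes "component s t"
  shows "m s + 2 \<le> l s \<longleftrightarrow> \<not> m t + 2 \<le> l t"
proof -
  have "\<not> (m s + 2 \<le> l s \<and> m t + 2 \<le> l t)"
    using no_col_pair[of s t] component_start_col[OF assms] assms by (auto simp: component_def)
  moreover have False if "\<not> m s + 2 \<le> l s" "\<not> m t + 2 \<le> l t"
  proof (rule no_row_pair_component[OF assms, of s "t - 1"])
    note a = component_start[OF assms that(1)] component_end[OF assms that(2)]
    then show "s \<le> s" "s < t" "l (Suc s) = l s" "s \<le> t - 1" "t - 1 < t" "m (Suc (t - 1)) = m (t - 1)"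
      by auto
    show "m (t - 1) \<le> l (Suc s)"
      using order_trans[OF m_anti[of s "t - 1"] m_le[of s]] a by auto
  qed
  ultimately show ?thesis by blast
qed

text \<open>The same exclusions across the boundary. If both adjacent rows are long, the two columns
  have common length \<open>Suc t\<close> and nothing obstructs their removal; if both are short,
  the equal parts of \<open>m\<close> lie above those of \<open>l\<close>.\<close>

lemma component_type_next:
  assumes "component s t" "component (Suc t) u"
  shows "m s + 2 \<le> l s \<longleftrightarrow> m (Suc t) + 2 \<le> l (Suc t)"
proof -
  have t: "m t = l (Suc t)" "Suc t < len l"
    using assms by (auto simp: component_def)
  have "\<not> (m t + 2 \<le> l t \<and> m (Suc t) + 2 \<le> l (Suc t))"
    using no_col_pair[of "Suc t" t] t by auto
  moreover have False if *: "\<not> m t + 2 \<le> l t" "\<not> m (Suc t) + 2 \<le> l (Suc t)"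
  proof -
    note a = component_start[OF assms(2) *(2)] component_end[OF assms(1) *(1)]
    have "Suc (Suc t) < len l"
      using a(1) assms(2) by (auto simp: component_def)
    then show False
      using no_row_pair_above[of "Suc t" "t - 1"] a t by auto
  qed
  ultimately show ?thesis
    using component_type[OF assms(1)] by blast
qed

lemma component_type_all:
  "component s t \<Longrightarrow> m s + 2 \<le> l s \<longleftrightarrow> m 0 + 2 \<le> l 0"
proof (induction s arbitrary: t rule: less_induct)
  case (less s)
  show ?case
  proof (cases s)
    case (Suc r)
    have r: "r < len l" "m r = l (Suc r)"
      using less.prems Suc by (auto simp: component_def)
    obtain s' t' where c: "component s' t'" "s' \<le> r" "r \<le> t'"
      using component_exists[OF r(1)] .
    then have "t' = r"
      using r(2) by (auto simp: component_def le_less)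
    then show ?thesis
      using less.IH[of s' t'] component_type_next[of s' r t] less.prems c Suc by auto
  qed simp
qed

lemma absurd: False
proof -
  obtain s t where c: "component s t"
    using component_exists[of 0] nonempty l_pos by blast
  then have t: "t < len l"
    by (simp add: component_def)
  show False
  proof (cases "m 0 + 2 \<le> l 0")
    case True
    \<comment> \<open>Equal parts of \<open>l\<close> would lie inside one component, whose end
      supplies equal parts of \<open>m\<close> for this type.\<close>
    have "l (Suc i) < l i" if i: "i < len l" for i
    proof (rule ccontr)
      assume "\<not> l (Suc i) < l i"
      then have eq: "l (Suc i) = l i"
        using l_anti[of i "Suc i"] by simp
      obtain s t where c: "component s t" "s \<le> i" "i \<le> t"
        using component_exists[OF i] .
      have "m i \<noteq> l (Suc i)"
        using m_lt[OF i] eq by simp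
      then have it: "i < t"
        using c by (auto simp: component_def le_less)
      have "\<not> m t + 2 \<le> l t"
        using True c component_type component_type_all by blast
      note e = component_end[OF c(1) this]
      have "m t \<le> m i" "m i \<le> l (Suc i)"
        using it m_anti m_le by auto
      moreover have "s \<le> t - 1" "t - 1 < t" "m (Suc (t - 1)) = m (t - 1)"
        using e by auto
      ultimately show False
        using no_row_pair_component[OF c(1), of i "t - 1"] c it eq e by auto
    qed
    then have "len l \<le> dp l"
      using dp_ge_strict[OF l_part] by blast
    then have "len l - 1 \<le> dp m"
      using dp_exact by simp
    moreover have "\<not> m t + 2 \<le> l t"
      using True component_type[OF c] component_type_all[OF c] by blast
    note e = component_end[OF c this]
    \<comment> \<open>The deletion only serves to count: the repeated part keeps
      \<open>dp m\<close>, yet at most \<open>len l - 2\<close> non-zero entries remain.\<close>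
    have "dp m = dp (del (t - 1) m)"
      using dp_del_eq[of "t - 1" m] e by simp
    moreover have "del (t - 1) m (len l - 2) = 0"
      using e(1) t m_zero[of "len l - 1"] by (auto simp: del_def Suc_diff_Suc numeral_2_eq_2)
    then have "dp (del (t - 1) m) \<le> len l - 2"
      by (rule dp_le[OF is_partition_del[OF m_part]])
    ultimately show False
      using e(1) t by simp
  next
    case False
    \<comment> \<open>Mirror image: now the start of every component supplies equal parts of
      \<open>l\<close>.\<close>
    have "m (Suc i) < m i" if i: "Suc i < len l" for i
    proof (rule ccontr)
      assume "\<not> m (Suc i) < m i"
      then have eq: "m (Suc i) = m i"
        using m_anti[of i "Suc i"] by simp
      obtain s t where c: "component s t" "s \<le> i" "i \<le> t"
        using component_exists[of i] i by auto
      have "m i \<noteq> l (Suc i)"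
        using m_lt[OF i] eq by simp
      then have it: "i < t"
        using c by (auto simp: component_def le_less)
      have "\<not> m s + 2 \<le> l s"
        using False c component_type_all by blast
      note e = component_start[OF c(1) this]
      have "m i \<le> m s" "m s \<le> l (Suc s)"
        using c m_anti m_le by auto
      then show False
        using no_row_pair_component[OF c(1), of s i] c it eq e by auto
    qed
    then have "len l - 1 \<le> dp m"
      using dp_ge_strict[OF m_part, of "len l - 1"] by auto
    then have "len l \<le> dp l"
      using dp_exact by simp
    moreover have "\<not> m s + 2 \<le> l s"
      using False component_type_all[OF c] by blast
    note e = component_start[OF c this]
    have "dp l = dp (del s l)"
      using dp_del_eq[of s l] e by simp
    moreover have "del s l (len l - 1) = 0"
      using e(1) t l_zero[of "len l"] by (auto simp: del_def)
    then have "dp (del s l) \<le> len l - 1"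
      by (rule dp_le[OF is_partition_del[OF l_part]])
    ultimately show False
      using t by simp
  qed
qed

end


section \<open>Equivalence of diagrams\<close>

text \<open>Arbitrary sets of boxes are allowed, so that equivalences can be assembled from pieces
  not given as pairs of partitions.\<close>

definition diagram_equiv :: "diagram \<Rightarrow> diagram \<Rightarrow> bool" where
  "diagram_equiv A B \<longleftrightarrow>
     (\<exists>f. bij_betw f (components A) (components B) \<and> (\<forall>C \<in> components A. translates C (f C)))"

lemma skew_equiv_iff:
  "(D, E) \<in> skew_equiv \<longleftrightarrow> basic D \<and> basic E \<and> diagram_equiv (boxes D) (boxes E)"
  by (simp add: skew_equiv_def diagram_equiv_def)

lemma diagram_equiv_trans:
  assumes "diagram_equiv A B" "diagram_equiv B C"
  shows "diagram_equiv A C"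
proof -
  obtain f g where "bij_betw f (components A) (components B)"
    "\<forall>X \<in> components A. translates X (f X)" "bij_betw g (components B) (components C)"
    "\<forall>X \<in> components B. translates X (g X)"
    using assms unfolding diagram_equiv_def by blast
  then have "bij_betw (g \<circ> f) (components A) (components C)"
    "\<forall>X \<in> components A. translates X ((g \<circ> f) X)"
    by (auto intro: bij_betw_trans) (metis bij_betwE translates_trans)
  then show ?thesis
    unfolding diagram_equiv_def by blast
qed

section \<open>Components of separated unions\<close>

lemma separated_sym: "separated A B \<Longrightarrow> separated B A"
  by (force simp: separated_def)

lemma separated_Un: "separated A (B \<union> C) \<longleftrightarrow> separated A B \<and> separated A C"
  by (auto simp: separated_def)

text \<open>A connected piece meeting both sides would decay into its two intersections.\<close>

lemma components_Un_subset:
  assumes "separated A B" "C \<in> components (A \<union> B)"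
  shows "C \<in> components A \<union> components B"
proof -
  have C: "C \<subseteq> A \<union> B" "C \<noteq> {}" "diagram_connected C" "separated C (A \<union> B - C)"
    using assms(2) by (auto simp: components_def)
  have "C \<inter> A = {} \<or> C \<inter> B = {}"
  proof (rule ccontr)
    assume "\<not> ?thesis"
    then have "decays C (C \<inter> A) (C \<inter> B)"
      using C(1) assms(1) by (auto simp: decays_def separated_def)
    then show False
      using C(3) by (auto simp: diagram_connected_def)
  qed
  then have "C \<subseteq> A \<or> C \<subseteq> B"
    using C(1) by blast
  then show ?thesis
    using C by (auto simp: components_def separated_def)
qed

lemma components_Un:
  assumes "separated A B"
  shows "components (A \<union> B) = components A \<union> components B"
proof
  show "components (A \<union> B) \<subseteq> components A \<union> components B"
    using components_Un_subset[OF assms] by blast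
  have *: "components X \<subseteq> components (X \<union> Y)" if "separated X Y" for X Y
  proof
    fix C
    assume "C \<in> components X"
    then have C: "C \<subseteq> X" "C \<noteq> {}" "diagram_connected C" "separated C (X - C)"
      by (auto simp: components_def)
    then have "separated C (X \<union> Y - C)"
      using that unfolding separated_def by blast
    then show "C \<in> components (X \<union> Y)"
      using C by (auto simp: components_def)
  qed
  show "components A \<union> components B \<subseteq> components (A \<union> B)"
    using *[OF assms] *[OF separated_sym[OF assms]] by (simp add: Un_commute)
qed

lemma components_disjoint:
  assumes "separated A B"
  shows "components A \<inter> components B = {}"
proof -
  have "A \<inter> B = {}"
    using assms by (auto simp: separated_def)
  then show ?thesis
    unfolding components_def by blast
qed

lemma diagram_equiv_Un:
  assumes "separated A B" "separated A' B'" "diagram_equiv A A'" "diagram_equiv B B'"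
  shows "diagram_equiv (A \<union> B) (A' \<union> B')"
proof -
  obtain f g where f: "bij_betw f (components A) (components A')"
    "\<forall>X \<in> components A. translates X (f X)" and g: "bij_betw g (components B) (components B')"
    "\<forall>X \<in> components B. translates X (g X)"
    using assms(3,4) unfolding diagram_equiv_def by blast
  define h where "h C = (if C \<in> components A then f C else g C)" for C
  note disj = components_disjoint[OF assms(1)] components_disjoint[OF assms(2)]
  have "bij_betw h (components A) (components A')"
    using f(1) by (subst bij_betw_cong[of _ _ f]) (simp_all add: h_def)
  moreover have "bij_betw h (components B) (components B')"
    using g(1) disj(1) by (subst bij_betw_cong[of _ _ g]) (auto simp: h_def)
  ultimately have "bij_betw h (components (A \<union> B)) (components (A' \<union> B'))"
    unfolding components_Un[OF assms(1)] components_Un[OF assms(2)]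
    by (rule bij_betw_combine[OF _ _ disj(2)])
  moreover have "\<forall>C \<in> components (A \<union> B). translates C (h C)"
    using f(2) g(2) by (auto simp: components_Un[OF assms(1)] h_def)
  ultimately show ?thesis
    unfolding diagram_equiv_def by blast
qed

section \<open>Translation of components\<close>

lemma separated_translate: "separated ((+) t ` A) ((+) t ` B) \<longleftrightarrow> separated A B"
  by (auto simp: separated_def)

lemma diagram_connected_translate:
  assumes "diagram_connected C"
  shows "diagram_connected ((+) t ` C)"
  unfolding diagram_connected_def
proof
  assume "\<exists>A B. decays ((+) t ` C) A B"
  then obtain A B where d: "A \<noteq> {}" "B \<noteq> {}" "(+) t ` C = A \<union> B" "separated A B"
    by (auto simp: decays_def)
  have "C = (+) (- t) ` ((+) t ` C)"
    by (simp add: image_image)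
  then have "C = (+) (- t) ` A \<union> (+) (- t) ` B"
    unfolding d(3) image_Un .
  then have "decays C ((+) (- t) ` A) ((+) (- t) ` B)"
    unfolding decays_def separated_translate using d by blast
  then show False
    using assms by (auto simp: diagram_connected_def)
qed

lemma components_translate_subset: "(+) t ` C \<in> components ((+) t ` A)" if "C \<in> components A"
proof -
  have "(+) t ` A - (+) t ` C = (+) t ` (A - C)"
    by (simp add: image_set_diff)
  then show ?thesis
    using that by (auto simp: components_def separated_translate diagram_connected_translate)
qed

lemma diagram_equiv_translate: "diagram_equiv A ((+) t ` A)"
proof -
  have "image ((+) t) ` components A = components ((+) t ` A)"
  proof
    show "image ((+) t) ` components A \<subseteq> components ((+) t ` A)"
      using components_translate_subset by blast
    show "components ((+) t ` A) \<subseteq> image ((+) t) ` components A"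
    proof
      fix C
      assume C: "C \<in> components ((+) t ` A)"
      have "(+) (- t) ` C \<in> components A"
        using components_translate_subset[OF C, of "- t"] by (simp add: image_image)
      moreover have "C = (+) t ` ((+) (- t) ` C)"
        by (simp add: image_image)
      ultimately show "C \<in> image ((+) t) ` components A"
        by blast
    qed
  qed
  moreover have "inj_on (image ((+) t)) (components A)"
    by (intro inj_onI) (simp add: inj_image_eq_iff)
  ultimately show ?thesis
    unfolding diagram_equiv_def bij_betw_def translates_def by blast
qed

lemma diagram_equiv_singleton: "diagram_equiv {a} {b}"
  using diagram_equiv_translate[of "{a}" "b - a"] by simp


section \<open>Adding a single box at the top right\<close>

text \<open>\<open>case_nat v p\<close> puts \<open>v\<close> in front of the sequence
  \<open>p\<close>. The new top row occupies column \<open>l 0\<close> alone, the first column to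
  the right of the old diagram.\<close>

fun add_box :: "skew \<Rightarrow> skew" where
  "add_box (l, m) = (case_nat (Suc (l 0)) l, case_nat (l 0) m)"

lemma is_partition_case_nat:
  assumes "is_partition p" "p 0 \<le> v"
  shows "is_partition (case_nat v p)"
  by (rule is_partitionI[of _ "Suc (len p)"])
    (auto simp: partition_zero_iff[OF assms(1)] assms(2) partition_antimono[OF assms(1)] split: nat.split)

lemma parts_case_nat:
  assumes "is_partition p" "p 0 \<le> v" "0 < v"
  shows "parts (case_nat v p) = add_mset v (parts p)"
proof -
  note c = is_partition_case_nat[OF assms(1,2)]
  have "i < len (case_nat v p) \<longleftrightarrow> i < Suc (len p)" for i
    unfolding partition_pos_iff[OF c, symmetric] using assms(3)
    by (auto simp: partition_pos_iff[OF assms(1)] split: nat.split)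
  then have "len (case_nat v p) = Suc (len p)"
    by (meson linorder_neqE_nat less_irrefl)
  moreover have "map (case_nat v p) [0..<Suc (len p)] = v # map p [0..<len p]"
    by (simp add: upt_conv_Cons flip: map_Suc_upt del: upt_Suc)
  ultimately show ?thesis
    by (simp add: parts_eq_mset[OF assms(1)] parts_eq_mset[OF c] del: upt_Suc)
qed

lemma basic_add_box: "basic D \<Longrightarrow> basic (add_box D)"
proof (cases D)
  case (Pair l m)
  assume "basic D"
  then have b: "is_partition l" "is_partition m" "\<And>i. m i \<le> l (Suc i) \<and> (m i < l i \<or> l i = 0)"
    by (auto simp: Pair basic_iff)
  have "m 0 \<le> l 0"
    using b(3)[of 0] partition_antimono[OF b(1), of 0 1] by simp
  then show ?thesis
    using b by (simp add: Pair basic_iff is_partition_case_nat split: nat.split)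
qed

lemma punion_row_part_first:
  assumes "is_partition p" "x \<le> p 0"
  shows "punion p (row_part x) 0 = p 0"
proof -
  let ?q = "punion p (row_part x)"
  have q: "is_partition ?q"
    by (rule is_partition_punion)
  have "set_mset (parts ?q) = set_mset (parts p) \<union> (if x = 0 then {} else {x})"
    by (simp add: parts_punion assms is_partition_row_part parts_row_part)
  then have r: "range ?q - {0} = (range p - {0}) \<union> (if x = 0 then {} else {x})"
    by (simp add: set_mset_parts q assms(1))
  have "?q 0 \<le> p 0"
  proof (cases "?q 0 = 0")
    case False
    then have "?q 0 \<in> (range p - {0}) \<union> (if x = 0 then {} else {x})"
      unfolding r[symmetric] by blast
    then show ?thesis
      using assms(2) partition_antimono[OF assms(1), of 0] by (auto split: if_splits)
  qed simp
  moreover have "p 0 \<le> ?q 0"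
  proof (cases "p 0 = 0")
    case False
    then have "p 0 \<in> range ?q - {0}"
      unfolding r by blast
    then show ?thesis
      using partition_antimono[OF q, of 0] by auto
  qed simp
  ultimately show ?thesis by simp
qed

lemma case_nat_punion:
  assumes "is_partition p" "p 0 \<le> v" "is_partition q" "q 0 \<le> v"
    and "punion p q 0 \<le> v" "0 < v"
  shows "case_nat v (punion p q) = punion (case_nat v p) q"
  by (rule punion_eqI[symmetric])
    (simp_all add: assms parts_case_nat is_partition_case_nat is_partition_punion parts_punion)

lemma len_case_nat:
  assumes "is_partition p" "p 0 \<le> v" "0 < v"
  shows "len (case_nat v p) = Suc (len p)"
  using parts_case_nat[OF assms] size_parts[OF assms(1)] size_parts[OF is_partition_case_nat[OF assms(1,2)]]
  by simp

text \<open>An added column pushes the top box one step to the right, which amounts to lengthening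
  \<open>x\<close> and \<open>y\<close> by one. An added row is no longer than the first part, so
  the box stays in its column.\<close>

lemma covers_add_box:
  assumes "covers D A"
  shows "covers (add_box D) (add_box A)"
proof -
  obtain l m a b where D: "D = (l, m)" and A: "A = (a, b)"
    by (metis surj_pair)
  have basic: "basic D" "basic A" "basic (add_box D)" "basic (add_box A)"
    using assms basic_add_box by (auto simp: covers_def)
  then have p: "is_partition a" "is_partition b" and b0: "b 0 \<le> a 0"
    using partition_antimono[of a 0 1] by (auto simp: A basic_iff intro: order_trans)
  consider x y where "y \<le> x" "x \<le> len a" "1 \<le> x" "l = psum a (col_part x)" "m = psum b (col_part y)"
    | x y where "y \<le> x" "x \<le> a 0" "1 \<le> x" "l = punion a (row_part x)" "m = punion b (row_part y)"
    using assms by (auto simp: covers_def A D skew_sum_def skew_union_def)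
  then show ?thesis
  proof cases
    case 1
    have "case_nat (Suc (l 0)) l = psum (case_nat (Suc (a 0)) a) (col_part (Suc x))"
      "case_nat (l 0) m = psum (case_nat (a 0) b) (col_part (Suc y))"
      using 1 by (auto simp: psum_def col_part_def fun_eq_iff split: nat.split)
    moreover have "Suc x \<le> len (case_nat (Suc (a 0)) a)"
      using 1 by (simp add: len_case_nat p)
    ultimately have "Suc y \<le> Suc x \<and> Suc x \<le> len (fst (add_box A)) \<and> 1 \<le> Suc x \<and>
        add_box D = skew_sum (add_box A) (col_part (Suc x), col_part (Suc y))"
      using 1(1) by (simp add: A D skew_sum_def)
    then show ?thesis
      unfolding covers_def using basic by blast
  next
    case 2
    have r: "row_part z 0 = z" for z
      by (simp add: row_part_def)
    have l0: "l 0 = a 0"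
      using punion_row_part_first[OF p(1) 2(2)] 2(4) by simp
    have "m 0 \<le> l 0"
      using basic(1) partition_antimono[of l 0 1] by (auto simp: D basic_iff intro: order_trans)
    then have "case_nat (l 0) m = punion (case_nat (a 0) b) (row_part y)"
      unfolding l0 2(5) using 2 l0 
      by (intro case_nat_punion p is_partition_row_part) (auto simp: r b0)
    moreover have "case_nat (Suc (l 0)) l = punion (case_nat (Suc (a 0)) a) (row_part x)"
      using 2 l0 case_nat_punion[OF p(1) _ is_partition_row_part, of "Suc (a 0)" x]
      by (simp add: r)
    ultimately have "y \<le> x \<and> x \<le> fst (add_box A) 0 \<and> 1 \<le> x \<and>
        add_box D = skew_union (add_box A) (row_part x, row_part y)"
      using 2 by (simp add: A D skew_union_def)
    then show ?thesis
      unfolding covers_def using basic by blast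
  qed
qed

lemma boxes_add_box:
  "boxes (add_box (l, m)) = {(0, int (l 0))} \<union> (+) (1, 0) ` boxes (l, m)"
proof -
  have "(x, y) \<in> boxes (add_box (l, m)) \<longleftrightarrow> (x, y) \<in> {(0, int (l 0))} \<union> (+) (1, 0) ` boxes (l, m)" for x y
  proof
    assume "(x, y) \<in> boxes (add_box (l, m))"
    then obtain i j where "x = int i" "y = int j" "case_nat (l 0) m i \<le> j" "j < case_nat (Suc (l 0)) l i"
      by (auto simp: boxes_def)
    then show "(x, y) \<in> {(0, int (l 0))} \<union> (+) (1, 0) ` boxes (l, m)"
      by (cases i) (force simp: boxes_def image_iff)+
  next
    assume "(x, y) \<in> {(0, int (l 0))} \<union> (+) (1, 0) ` boxes (l, m)"
    then consider "x = int 0" "y = int (l 0)" | i j where "x = int (Suc i)" "y = int j" "m i \<le> j" "j < l i"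
      by (auto simp: boxes_def)
    then show "(x, y) \<in> boxes (add_box (l, m))"
    proof cases
      case 1
      then show ?thesis by (auto simp: boxes_def intro!: exI[of _ "0::nat"])
    next
      case 2
      then show ?thesis by (auto simp: boxes_def intro!: exI[of _ "Suc i"])
    qed
  qed
  then show ?thesis by (simp add: set_eq_iff split_paired_all)
qed

lemma separated_add_box:
  assumes "basic (l, m)"
  shows "separated {(0, int (l 0))} ((+) (1, 0) ` boxes (l, m))"
proof -
  have "is_partition l"
    using assms by (simp add: basic_iff)
  then have "\<not> l 0 < l i" for i
    using partition_antimono[of l 0 i] by simp
  then show ?thesis
    by (auto simp: separated_def boxes_def)
qed

lemma diagram_equiv_untranslate: "diagram_equiv ((+) t ` A) A"
  using diagram_equiv_translate[of "(+) t ` A" "- t"] by (simp add: image_image)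

text \<open>The new boxes may sit in different columns, but all single boxes are translates of each
  other.\<close>

lemma skew_equiv_add_box:
  assumes "(D, E) \<in> skew_equiv"
  shows "(add_box D, add_box E) \<in> skew_equiv"
proof -
  obtain l m a b where D: "D = (l, m)" and E: "E = (a, b)"
    by (metis surj_pair)
  have b: "basic (l, m)" "basic (a, b)" "diagram_equiv (boxes (l, m)) (boxes (a, b))"
    using assms by (auto simp: D E skew_equiv_iff)
  have "diagram_equiv (boxes (add_box (l, m))) (boxes (add_box (a, b)))"
    unfolding boxes_add_box using b
    by (blast intro: diagram_equiv_Un separated_add_box diagram_equiv_singleton
        diagram_equiv_trans diagram_equiv_translate diagram_equiv_untranslate)
  then show ?thesis
    using b basic_add_box by (simp add: D E skew_equiv_iff del: add_box.simps)
qed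

text \<open>Truncated subtraction makes \<open>n = 0\<close> fit: the empty diagram becomes a single
  box.\<close>

lemma add_box_staircase:
  "add_box (staircase n, staircase (n - 1)) = (staircase (Suc n), staircase n)"
  by (auto simp: staircase_def fun_eq_iff split: nat.split)


section \<open>Moving an isolated box to the top right\<close>

text \<open>Row \<open>k\<close> goes together with the column of its box, which would otherwise be
  left empty; hence the rows above slide one column to the left.\<close>

definition drop_row :: "nat \<Rightarrow> partition \<Rightarrow> partition" where
  "drop_row k p = (\<lambda>i. if i < k then p i - 1 else p (Suc i))"

text \<open>The map undoes the decrement: values from \<open>c\<close> upward come from rows above
  \<open>k\<close>, smaller ones from rows below. It misses \<open>c\<close>, so exactly one value
  is lost.\<close>

lemma range_drop_row:
  assumes p: "\<And>i. i < k \<Longrightarrow> c < p i" "\<And>i. k < i \<Longrightarrow> p i < c" and c: "p k = c"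
  shows "range p = insert c ((\<lambda>v. if c \<le> v then Suc v else v) ` range (drop_row k p))"
proof -
  define h where "h v = (if c \<le> v then Suc v else v)" for v
  have h1: "h (drop_row k p i) = (if i < k then p i else p (Suc i))" for i
    using p(1)[of i] p(2)[of "Suc i"] by (cases "i < k") (auto simp: h_def drop_row_def)
  have "p i \<in> insert c (range (\<lambda>i. h (drop_row k p i)))" for i
  proof (cases i k rule: linorder_cases)
    case less
    then have "p i = h (drop_row k p i)" by (simp add: h1)
    then show ?thesis by blast
  next
    case greater
    then have "p i = h (drop_row k p (i - 1))" by (cases i) (auto simp: h1)
    then show ?thesis by blast
  qed (simp add: c)
  moreover have "insert c (range (\<lambda>i. h (drop_row k p i))) \<subseteq> range p"
    using c by (auto simp: h1)
  ultimately have "range p = insert c (h ` range (drop_row k p))"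
    unfolding image_image by blast
  then show ?thesis
    unfolding h_def .
qed

lemma card_insert_shift:
  fixes c :: nat
  assumes "finite R"
  shows "card (insert c ((\<lambda>v. if c \<le> v then Suc v else v) ` R)) = Suc (card R)"
proof -
  define h where "h v = (if c \<le> v then Suc v else v)" for v
  have "inj h"
    by (auto simp: inj_def h_def split: if_splits)
  then have "card (h ` R) = card R"
    by (rule card_image[OF inj_on_subset[OF _ subset_UNIV]])
  moreover have "c \<notin> h ` R"
    by (auto simp: h_def)
  ultimately show ?thesis
    using assms unfolding h_def[symmetric] by simp
qed

locale isolated_box =
  fixes l m :: partition and k :: nat
  assumes basic: "basic (l, m)"
    and above: "k = 0 \<or> m (k - 1) = l k"
    and below: "m k = l (Suc k)"
    and box: "l k = Suc (m k)"
begin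

lemma l_part: "is_partition l" and m_part: "is_partition m"
  and m_le: "m i \<le> l (Suc i)" and m_lt: "m i < l i \<or> l i = 0"
  using basic by (auto simp: basic_iff)

lemmas l_anti = partition_antimono[OF l_part]
lemmas m_anti = partition_antimono[OF m_part]

lemma m_above: "i < k \<Longrightarrow> l k \<le> m i"
  using above m_anti[of i "k - 1"] by (cases k) auto

lemma l_above: "i < k \<Longrightarrow> l k < l i"
  using m_above[of i] m_lt[of i] l_anti[of i k] box by auto

lemma l_below: "k < i \<Longrightarrow> l i \<le> m k"
  using l_anti[of "Suc k" i] below by simp

lemma basic_drop: "basic (drop_row k l, drop_row k m)"
  unfolding basic_iff
proof (intro conjI allI)
  show "is_partition (drop_row k l)"
  proof (rule is_partitionI[of _ "len l"])
    show "drop_row k l (Suc i) \<le> drop_row k l i" for i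
      using l_anti[of i "Suc i"] l_anti[of "Suc i" "Suc (Suc i)"] l_above[of i]
      by (cases "Suc i = k") (auto simp: drop_row_def)
    show "drop_row k l (len l) = 0"
      using partition_zero_iff[OF l_part, of "len l"] partition_zero_iff[OF l_part, of "Suc (len l)"]
      by (simp add: drop_row_def)
  qed
  show "is_partition (drop_row k m)"
  proof (rule is_partitionI[of _ "len m"])
    show "drop_row k m (Suc i) \<le> drop_row k m i" for i
      using m_anti[of i "Suc i"] m_anti[of "Suc i" "Suc (Suc i)"] m_above[of i] box
      by (cases "Suc i = k") (auto simp: drop_row_def)
    show "drop_row k m (len m) = 0"
      using partition_zero_iff[OF m_part, of "len m"] partition_zero_iff[OF m_part, of "Suc (len m)"]
      by (simp add: drop_row_def)
  qed
  fix i
  show "drop_row k m i \<le> drop_row k l (Suc i)"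
    using m_le[of i] m_le[of "Suc i"] above below box
    by (cases "Suc i = k") (auto simp: drop_row_def)
  show "drop_row k m i < drop_row k l i \<or> drop_row k l i = 0"
    using m_lt[of i] m_lt[of "Suc i"] m_above[of i] box by (auto simp: drop_row_def)
qed

lemma drop_size: "drop_row k l 0 + len (drop_row k l) < l 0 + len l"
proof -
  have d: "is_partition (drop_row k l)"
    using basic_drop by (simp add: basic_iff)
  have "k < len l"
    using box partition_pos_iff[OF l_part, of k] by simp
  then have "drop_row k l (len l - 1) = 0"
    using partition_zero_iff[OF l_part, of "len l"] by (auto simp: drop_row_def)
  then have "len (drop_row k l) \<le> len l - 1"
    using partition_zero_iff[OF d] by simp
  moreover have "drop_row k l 0 \<le> l 0"
    using l_anti[of 0 1] by (auto simp: drop_row_def)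
  ultimately show ?thesis
    using \<open>k < len l\<close> by simp
qed

lemma dp_drop_l: "dp l = Suc (dp (drop_row k l))"
proof -
  have d: "is_partition (drop_row k l)"
    using basic_drop by (simp add: basic_iff)
  have "range l = insert (l k) ((\<lambda>v. if l k \<le> v then Suc v else v) ` range (drop_row k l))"
    by (rule range_drop_row) (use l_above l_below box in \<open>auto simp: less_Suc_eq_le\<close>)
  then have "card (range l) = Suc (card (range (drop_row k l)))"
    using card_insert_shift partition_finite_range[OF d] by metis
  then show ?thesis
    by (simp add: card_range_partition l_part d)
qed

text \<open>Some box must remain: for a lone box \<open>m\<close> is zero before and after, and its
  \<open>dp\<close> cannot drop.\<close>

lemma dp_drop_m:
  assumes "drop_row k l 0 \<noteq> 0"
  shows "dp m = Suc (dp (drop_row k m))"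
proof -
  have d: "is_partition (drop_row k m)"
    using basic_drop by (simp add: basic_iff)
  have "range m = insert (m k) ((\<lambda>v. if m k \<le> v then Suc v else v) ` range (drop_row k m))"
  proof (cases "m k = 0")
    case False
    have "m i < m k" if "k < i" for i
      using m_anti[of "Suc k" i] m_lt[of "Suc k"] below False that by simp
    moreover have "m k < m i" if "i < k" for i
      using m_above[OF that] box by simp
    ultimately show ?thesis
      using range_drop_row[where c = "m k" and p = m] by blast
  next
    \<comment> \<open>The box lies in the last row, so the value 0 recurs further down and
      \<open>range_drop_row\<close> does not apply. The missing value \<open>Suc 0\<close> is
      supplied by \<open>m (k - 1) = 1\<close>.\<close>
    case True
    have below0: "m i = 0" if "k \<le> i" for i
      using m_anti[OF that] True by simp
    have k: "0 < k"
      using assms below True by (cases k) (auto simp: drop_row_def)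
    then have mk: "m (k - 1) = 1"
      using above box True by simp
    have "range m \<subseteq> insert 0 (Suc ` range (drop_row k m))"
    proof
      fix v assume "v \<in> range m"
      then obtain i where i: "v = m i" by blast
      show "v \<in> insert 0 (Suc ` range (drop_row k m))"
      proof (cases "i < k")
        case True
        then have "v = Suc (drop_row k m i)"
          using i m_above[of i] box by (simp add: drop_row_def)
        then show ?thesis by blast
      qed (simp add: i below0)
    qed
    moreover have "Suc (drop_row k m i) \<in> range m" for i
    proof (cases "i < k")
      case True
      then have "Suc (drop_row k m i) = m i"
        using m_above[of i] box by (simp add: drop_row_def)
      then show ?thesis by simp
    next
      case False
      then have "Suc (drop_row k m i) = m (k - 1)"
        using below0 mk by (simp add: drop_row_def)
      then show ?thesis by simp
    qed
    moreover have "0 \<in> range m"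
      using True by (metis rangeI)
    ultimately show ?thesis
      unfolding True by auto
  qed
  then have "card (range m) = Suc (card (range (drop_row k m)))"
    using card_insert_shift partition_finite_range[OF d] by metis
  then show ?thesis
    by (simp add: card_range_partition m_part d)
qed

lemma delta_drop: "delta_value (l, m) = Suc (delta_value (drop_row k l, drop_row k m))"
proof (cases "drop_row k l 0 = 0")
  case True
  then have "dp (drop_row k l) = 0"
    using dp_le[of "drop_row k l" 0] basic_drop by (simp add: basic_iff)
  then show ?thesis
    using dp_drop_l by (simp add: delta_value_def)
next
  case False
  then show ?thesis
    using dp_drop_l dp_drop_m by (simp add: delta_value_def)
qed

lemma equiv_drop: "((l, m), add_box (drop_row k l, drop_row k m)) \<in> skew_equiv"
proof -
  let ?l = "drop_row k l" and ?m = "drop_row k m"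
  \<comment> \<open>\<open>P\<close> lies above and to the right of the box, \<open>S\<close> below
    and to the left. Dropping moves \<open>P\<close> left and \<open>S\<close> up, and adding the
    box moves both down, so each piece is only translated.\<close>
  define P where "P = {(int i, int j) | i j. i < k \<and> m i \<le> j \<and> j < l i}"
  define S where "S = {(int i, int j) | i j. k < i \<and> m i \<le> j \<and> j < l i}"
  define P' where "P' = (+) (0, - 1) ` P"
  define S' where "S' = (+) (- 1, 0) ` S"
  have D: "boxes (l, m) = P \<union> ({(int k, int (m k))} \<union> S)"
  proof -
    have "(x, y) \<in> boxes (l, m) \<longleftrightarrow> (x, y) \<in> P \<union> ({(int k, int (m k))} \<union> S)" for x y
    proof
      assume "(x, y) \<in> boxes (l, m)"
      then obtain i j where "x = int i" "y = int j" "m i \<le> j" "j < l i"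
        by (auto simp: boxes_def)
      then show "(x, y) \<in> P \<union> ({(int k, int (m k))} \<union> S)"
        using box by (cases i k rule: linorder_cases) (auto simp: P_def S_def)
    qed (auto simp: P_def S_def boxes_def box)
    then show ?thesis by auto
  qed
  have E: "boxes (?l, ?m) = P' \<union> S'"
  proof -
    have "(x, y) \<in> boxes (?l, ?m) \<longleftrightarrow> (x, y) \<in> P' \<union> S'" for x y
    proof
      assume "(x, y) \<in> boxes (?l, ?m)"
      then obtain i j where ij: "x = int i" "y = int j" "?m i \<le> j" "j < ?l i"
        by (auto simp: boxes_def)
      show "(x, y) \<in> P' \<union> S'"
      proof (cases "i < k")
        case True
        then have "(int i, int (Suc j)) \<in> P"
          using ij unfolding P_def drop_row_def
          by (intro CollectI exI[of _ i] exI[of _ "Suc j"]) auto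
        then show ?thesis
          unfolding P'_def ij by (intro UnI1 image_eqI[rotated]) auto
      next
        case False
        then have "(int (Suc i), int j) \<in> S"
          using ij unfolding S_def drop_row_def
          by (intro CollectI exI[of _ "Suc i"] exI[of _ j]) auto
        then show ?thesis
          unfolding S'_def ij by (intro UnI2 image_eqI[rotated]) auto
      qed
    next
      assume "(x, y) \<in> P' \<union> S'"
      then consider i j where "x = int i" "y = int j - 1" "i < k" "m i \<le> j" "j < l i"
        | i j where "x = int i - 1" "y = int j" "k < i" "m i \<le> j" "j < l i"
        by (auto simp: P'_def S'_def P_def S_def)
      then show "(x, y) \<in> boxes (?l, ?m)"
      proof cases
        case 1
        \<comment> \<open>The subtraction is exact because
          \<open>j \<ge> m i \<ge> l k \<ge> 1\<close>.\<close>
        then have "y = int (j - 1)" "?m i \<le> j - 1" "j - 1 < ?l i"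
          using m_above[of i] box by (auto simp: drop_row_def)
        then show ?thesis
          unfolding 1(1) boxes_def by blast
      next
        case 2
        then have "x = int (i - 1)" "?m (i - 1) \<le> j" "j < ?l (i - 1)"
          by (auto simp: drop_row_def)
        then show ?thesis
          unfolding 2(2) boxes_def by blast
      qed
    qed
    then show ?thesis by auto
  qed
  have P: "x < int k \<and> int (l k) \<le> y" if "(x, y) \<in> P" for x y
    using that m_above by (force simp: P_def)
  have S: "int k < x \<and> y < int (m k)" if "(x, y) \<in> S" for x y
    using that l_below by (force simp: S_def)
  have "separated P ({(int k, int (m k))} \<union> S)" "separated {(int k, int (m k))} S"
    using P S box by (force simp: separated_def)+
  moreover have "separated P' S'"
    using P S box by (force simp: separated_def P'_def S'_def)
  then have "separated ((+) (1, 0) ` P') ((+) (1, 0) ` S')"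
    by (simp add: separated_translate)
  moreover have "separated {(0, int (?l 0))} ((+) (1, 0) ` P' \<union> (+) (1, 0) ` S')"
    using separated_add_box[OF basic_drop] unfolding E image_Un .
  then have "separated {(0, int (?l 0))} ((+) (1, 0) ` P')" "separated {(0, int (?l 0))} ((+) (1, 0) ` S')"
    by (simp_all add: separated_Un)
  ultimately have sep: "separated P ({(int k, int (m k))} \<union> S)" "separated {(int k, int (m k))} S"
    "separated ((+) (1, 0) ` P') ({(0, int (?l 0))} \<union> (+) (1, 0) ` S')"
    "separated {(0, int (?l 0))} ((+) (1, 0) ` S')"
    using separated_sym unfolding separated_Un by blast+
  have "diagram_equiv P ((+) (1, 0) ` P')" "diagram_equiv S ((+) (1, 0) ` S')"
    unfolding P'_def S'_def
    by (rule diagram_equiv_trans[OF diagram_equiv_translate diagram_equiv_translate])+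
  then have "diagram_equiv (P \<union> ({(int k, int (m k))} \<union> S))
      ((+) (1, 0) ` P' \<union> ({(0, int (?l 0))} \<union> (+) (1, 0) ` S'))"
    using sep by (intro diagram_equiv_Un diagram_equiv_singleton)
  moreover have "(+) (1, 0) ` P' \<union> ({(0, int (?l 0))} \<union> (+) (1, 0) ` S') = boxes (add_box (?l, ?m))"
    unfolding boxes_add_box E image_Un by blast
  ultimately show ?thesis
    unfolding skew_equiv_iff D using basic basic_add_box[OF basic_drop] by simp
qed

end


section \<open>Descent to the staircase\<close>

text \<open>Working with diagrams instead of classes lets \<open>add_box\<close> be applied along a
  whole chain; moves within a class disappear in \<open>steps_class_ge\<close>.\<close>

definition step :: "skew \<Rightarrow> skew \<Rightarrow> bool" where
  "step D E \<longleftrightarrow> covers D E \<or> (D, E) \<in> skew_equiv"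

lemma step_add_box: "step D E \<Longrightarrow> step (add_box D) (add_box E)"
  unfolding step_def using covers_add_box skew_equiv_add_box by blast

lemma steps_add_box: "step\<^sup>*\<^sup>* D E \<Longrightarrow> step\<^sup>*\<^sup>* (add_box D) (add_box E)"
  by (induction rule: rtranclp_induct) (auto intro: rtranclp.rtrancl_into_rtrancl step_add_box)

lemma steps_class_ge:
  assumes "step\<^sup>*\<^sup>* D E"
  shows "class_ge (skew_class D) (skew_class E)"
  using assms
proof (induction rule: rtranclp_induct)
  case base
  then show ?case by (simp add: class_ge_def)
next
  case (step E F)
  show ?case
  proof (cases "(E, F) \<in> skew_equiv")
    case True
    then show ?thesis
      using step.IH equiv_class_eq[OF equiv_skew_equiv] by (simp add: skew_class_def)
  next
    case False
    then have c: "covers E F"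
      using step.hyps by (simp add: step_def)
    then have b: "basic E" "basic F"
      by (auto simp: covers_def)
    then have "E \<in> skew_class E" "F \<in> skew_class F"
      "skew_class E \<in> skew_classes" "skew_class F \<in> skew_classes"
      using equiv_class_self[OF equiv_skew_equiv]
      by (auto simp: skew_class_def skew_classes_def intro: quotientI)
    then have "class_covers (skew_class E) (skew_class F)"
      unfolding class_covers_def using c by blast
    then show ?thesis
      using step.IH by (simp add: class_ge_def)
  qed
qed

lemma steps_to_staircase:
  "basic (l, m) \<Longrightarrow> delta_value (l, m) = n \<Longrightarrow> step\<^sup>*\<^sup>* (l, m) (staircase n, staircase (n - 1))"
proof (induction "l 0 + len l" arbitrary: l m n rule: less_induct)
  case less
  note basic = less.prems(1)
  then have part: "is_partition l" and m_le: "\<And>i. m i \<le> l (Suc i)"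
    by (auto simp: basic_iff)
  consider "l 0 = 0" | i where "isolated_box l m i"
    | D where "covers (l, m) D" "delta_value D = n"
  proof (rule ccontr)
    \<comment> \<open>If none of the three cases occurs, the diagram satisfies the assumptions of
      the contradictory locale.\<close>
    assume "\<not> thesis"
    with that have *: "0 < l 0" "\<And>i. \<not> isolated_box l m i"
      "\<And>D. covers (l, m) D \<Longrightarrow> delta_value D \<noteq> n"
      by blast+
    have "irreducible_skew l m"
      using basic * less.prems(2) by unfold_locales (auto simp: isolated_box_def)
    then show False
      by (rule irreducible_skew.absurd)
  qed
  then show ?case
  proof cases
    case 1
    then have l: "l i = 0" for i
      using partition_antimono[OF part, of 0 i] by simp
    moreover have m: "m i = 0" for i
      using m_le[of i] l by simp
    moreover have "n = 0"
      using dp_le[OF part 1] less.prems(2) by (simp add: delta_value_def)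
    ultimately have "(l, m) = (staircase n, staircase (n - 1))"
      by (auto simp: staircase_def)
    then show ?thesis by simp
  next
    case (2 i)
    then interpret isolated_box l m i .
    let ?D = "(drop_row i l, drop_row i m)" and ?n = "delta_value (drop_row i l, drop_row i m)"
    \<comment> \<open>Descend without the isolated box, then put it back on every diagram of the
      chain; this raises the index of the staircase by one, matching
      \<open>delta_drop\<close>.\<close>
    have "step\<^sup>*\<^sup>* (add_box ?D) (add_box (staircase ?n, staircase (?n - 1)))"
      by (intro steps_add_box less.hyps drop_size basic_drop refl)
    moreover have "step (l, m) (add_box ?D)"
      using equiv_drop by (simp add: step_def)
    moreover have "n = Suc ?n"
      using delta_drop less.prems(2) by simp
    ultimately show ?thesis
      by (metis add_box_staircase converse_rtranclp_into_rtranclp diff_Suc_1)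
  next
    case (3 D)
    obtain a b where D: "D = (a, b)" by fastforce
    have "step\<^sup>*\<^sup>* (a, b) (staircase n, staircase (n - 1))"
      using 3 covers_size[of l m a b] by (intro less.hyps) (auto simp: D covers_def)
    then show ?thesis
      using 3(1) by (auto simp: D step_def intro: converse_rtranclp_into_rtranclp)
  qed
qed

theorem theorem2p3:
  fixes lam mu :: partition and n :: nat
  assumes "basic (lam, mu)"
    and "delta_value (lam, mu) = n"
  shows "class_ge (skew_class (lam, mu)) (skew_class (staircase n, staircase (n - 1)))"
  using steps_class_ge[OF steps_to_staircase[OF assms]] .

end
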